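(* Consider the system, the costs and the MPC feedback $\mu$ with prediction horizon $N\in\mathbb{I}_{\ge 1}$ described in the context, and let $\sigma:X\to\mathbb{R}_{\ge 0}$. Assume: (Exponential cost controllability) there are constants $\bar\gamma\ge 0$ and $\gamma_k\in[0,\bar\gamma]$, $k\in\mathbb{I}_{\ge 1}$, such that $V_k(x)\le\gamma_k\sigma(x)$ for all $x\in X$ and all $k\in\mathbb{I}_{\ge1}$; (Cost detectability) there are a function $W:X\to\mathbb{R}_{\ge 0}$ and constants $\epsilon_{\mathrm{o}}>0$, $\underline{\gamma}_{\mathrm{o}},\overline{\gamma}_{\mathrm{o}}\ge 0$ such that for all $(x,u)\in X\times\mathbb{U}$ $$\underline{\gamma}_{\mathrm{o}}\sigma(x)\le W(x)\le\overline{\gamma}_{\mathrm{o}}\sigma(x),\qquad W(f(x,u))-W(x)\le-\epsilon_{\mathrm{o}}\sigma(x)+\ell(x,u).$$ Let $\alpha_N$ be the real number defined by the following linear program in the real variables $\tilde\ell_k$ ($k\in\mathbb{I}_{[0,N-1]}$), $\tilde W_k,\tilde\sigma_k$ ($k\in\mathbb{I}_{[0,N]}$), $\tilde V$: $$\epsilon_{\mathrm{o}}(\alpha_N-1)=\min_{\tilde\ell,\tilde W,\tilde\sigma,\tilde V}\ \sum_{k=1}^{N-1}\tilde\ell_k-\tilde V$$ subject to \begin{align*} &\tilde\sigma_0=1,\\ &\tilde\ell_k\ge0,\ k\in\mathbb{I}_{[0,N-1]},\qquad \tilde\sigma_k\ge0,\ \tilde W_k\ge0,\ k\in\mathbb{I}_{[0,N]},\\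 &\underline{\gamma}_{\mathrm{o}}\tilde\sigma_k\le\tilde W_k\le\overline{\gamma}_{\mathrm{o}}\tilde\sigma_k,\ k\in\mathbb{I}_{[0,N]},\\ &\tilde W_{k+1}-\tilde W_k\le-\epsilon_{\mathrm{o}}\tilde\sigma_k+\tilde\ell_k,\ k\in\mathbb{I}_{[0,N-1]},\\ &\textstyle\sum_{j=k}^{N-1}\tilde\ell_j\le\gamma_{N-k}\tilde\sigma_k,\ k\in\mathbb{I}_{[0,N-1]},\\ &\textstyle\tilde V\le\sum_{j=1}^{k-1}\tilde\ell_j+\gamma_{N-k+1}\tilde\sigma_k,\ k\in\mathbb{I}_{[1,N]}. \end{align*} Then, with $Y_N:=V_N+W$ and $Y_\infty:=V_\infty+W$, for all $x\in X$ $$\epsilon_{\mathrm{o}}\sigma(x)\le Y_N(x)\le(\gamma_N+\overline{\gamma}_{\mathrm{o}})\sigma(x),\qquad Y_N(f(x,\mu(x)))-Y_N(x)\le-\epsilon_{\mathrm{o}}\alpha_N\sigma(x),$$ and for all $x_0\in X$ $$\alpha_N\big(\mathcal{J}^\mu_\infty(x_0)+W(x_0)\big)\le Y_\infty(x_0).$$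
   Context: $\mathbb{I}_{[a,b]}$ (resp. $\mathbb{I}_{\ge a}$) denotes the integers in $[a,b]$ (resp. $\ge a$); empty sums are $0$. System: $x(k+1)=f(x(k),u(k))$ with state space $X=\mathbb{R}^n$, input constraint set $\mathbb{U}\subseteq\mathbb{R}^m$, $f:X\times\mathbb{U}\to X$. For $x\in X$ and an input sequence $u(\cdot)$ in $\mathbb{U}$, $x_u(k,x)$ is the state after $k$ steps, with $x_u(0,x)=x$. Stage cost: $\ell:X\times\mathbb{U}\to\mathbb{R}_{\ge 0}$. For $k\in\mathbb{I}_{\ge 1}$: $\mathcal{J}_k(x,u)=\sum_{j=0}^{k-1}\ell(x_u(j,x),u(j))$ and $V_k(x)=\inf_{u\in\mathbb{U}^k}\mathcal{J}_k(x,u)$. Infinite-horizon optimal cost: $V_\infty(x)=\inf_{u\in\mathbb{U}^\infty}\sum_{k=0}^\infty\ell(x_u(k,x),u(k))$. It is assumed throughout that a minimizer $u^*_{N,x}\in\mathbb{U}^N$ of $\mathcal{J}_N(x,\cdot)$ exists for each $x$. The MPC feedback is $\mu(x):=u^*_{N,x}(0)$. The closed loop from $x_0$ is $x_\mu(0)=x_0$, $u_\mu(k)=\mu(x_\mu(k))$, $x_\mu(k+1)=f(x_\mu(k),u_\mu(k))$, and its cost is $\mathcal{J}^\mu_\infty(x_0):=\sum_{k=0}^\infty\ell(x_\mu(k),u_\mu(k))\in[0,\infty]$. The convention $0\cdot\infty=0$ is used in the performance bound. *)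

theory Defs
  imports "HOL-Analysis.Analysis"
begin

text \<open>
  The state space is \<open>real ^ 'n\<close>; \<open>f\<close> and the stage cost \<open>l\<close> are total functions, but are only
  ever evaluated at inputs from the constraint set \<open>U\<close>. Finite input sequences (elements
  of the \<open>k\<close>-fold power of \<open>U\<close>) are the extensional functions \<open>{..<k} \<rightarrow>\<^sub>E U\<close>, infinite ones are
  the functions \<open>UNIV \<rightarrow> U\<close>.
\<close>

primrec traj :: "(real ^ 'n \<Rightarrow> real ^ 'm \<Rightarrow> real ^ 'n) \<Rightarrow> (nat \<Rightarrow> real ^ 'm) \<Rightarrow> real ^ 'n \<Rightarrow> nat \<Rightarrow> real ^ 'n"
  where
    "traj f u x 0 = x"
  | "traj f u x (Suc k) = f (traj f u x k) (u k)"

definition cost ::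
    "(real ^ 'n \<Rightarrow> real ^ 'm \<Rightarrow> real ^ 'n) \<Rightarrow> (real ^ 'n \<Rightarrow> real ^ 'm \<Rightarrow> real) \<Rightarrow>
     nat \<Rightarrow> real ^ 'n \<Rightarrow> (nat \<Rightarrow> real ^ 'm) \<Rightarrow> real"
  where "cost f l k x u = (\<Sum>j<k. l (traj f u x j) (u j))"

text \<open>
  The following infimum is over a set of reals; it is the true infimum because the stage cost
  is nonnegative and \<open>U\<close> is nonempty whenever minimizers for some positive horizon exist.
\<close>

definition opt_cost ::
    "(real ^ 'n \<Rightarrow> real ^ 'm \<Rightarrow> real ^ 'n) \<Rightarrow> (real ^ 'm) set \<Rightarrow> (real ^ 'n \<Rightarrow> real ^ 'm \<Rightarrow> real) \<Rightarrow>
     nat \<Rightarrow> real ^ 'n \<Rightarrow> real"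
  where "opt_cost f U l k x = (INF u \<in> {..<k} \<rightarrow>\<^sub>E U. cost f l k x u)"

definition opt_cost_inf ::
    "(real ^ 'n \<Rightarrow> real ^ 'm \<Rightarrow> real ^ 'n) \<Rightarrow> (real ^ 'm) set \<Rightarrow> (real ^ 'n \<Rightarrow> real ^ 'm \<Rightarrow> real) \<Rightarrow>
     real ^ 'n \<Rightarrow> ereal"
  where "opt_cost_inf f U l x = (INF u \<in> UNIV \<rightarrow> U. \<Sum>k. ereal (l (traj f u x k) (u k)))"

primrec closed_loop ::
    "(real ^ 'n \<Rightarrow> real ^ 'm \<Rightarrow> real ^ 'n) \<Rightarrow> (real ^ 'n \<Rightarrow> real ^ 'm) \<Rightarrow> real ^ 'n \<Rightarrow> nat \<Rightarrow> real ^ 'n"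
  where
    "closed_loop f \<mu> x 0 = x"
  | "closed_loop f \<mu> x (Suc k) = f (closed_loop f \<mu> x k) (\<mu> (closed_loop f \<mu> x k))"

definition closed_loop_cost ::
    "(real ^ 'n \<Rightarrow> real ^ 'm \<Rightarrow> real ^ 'n) \<Rightarrow> (real ^ 'n \<Rightarrow> real ^ 'm \<Rightarrow> real) \<Rightarrow>
     (real ^ 'n \<Rightarrow> real ^ 'm) \<Rightarrow> real ^ 'n \<Rightarrow> ereal"
  where "closed_loop_cost f l \<mu> x =
    (\<Sum>k. ereal (l (closed_loop f \<mu> x k) (\<mu> (closed_loop f \<mu> x k))))"

text \<open>
  A candidate point of the linear program is a tuple of three real sequences (stage costs, storage
  values, state measures) and one real number (value at the successor state). Only the
  entries with index below \<open>N\<close> (stage costs), respectively at most \<open>N\<close>, are decision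
  variables; the remaining entries are unconstrained and do not influence the objective.
\<close>

type_synonym lp_point = "(nat \<Rightarrow> real) \<times> (nat \<Rightarrow> real) \<times> (nat \<Rightarrow> real) \<times> real"

definition lp_objective :: "nat \<Rightarrow> lp_point \<Rightarrow> real"
  where "lp_objective N = (\<lambda>(lt, Wt, st, Vt). (\<Sum>k=1..<N. lt k) - Vt)"

definition lp_feasible :: "nat \<Rightarrow> (nat \<Rightarrow> real) \<Rightarrow> real \<Rightarrow> real \<Rightarrow> real \<Rightarrow> lp_point \<Rightarrow> bool"
  where "lp_feasible N \<gamma> \<epsilon>o \<gamma>lo \<gamma>hi = (\<lambda>(lt, Wt, st, Vt).
    st 0 = 1 \<and>
    (\<forall>k<N. 0 \<le> lt k) \<and>
    (\<forall>k\<le>N. 0 \<le> st k \<and> 0 \<le> Wt k) \<and>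
    (\<forall>k\<le>N. \<gamma>lo * st k \<le> Wt k \<and> Wt k \<le> \<gamma>hi * st k) \<and>
    (\<forall>k<N. Wt (k + 1) - Wt k \<le> - \<epsilon>o * st k + lt k) \<and>
    (\<forall>k<N. (\<Sum>j=k..<N. lt j) \<le> \<gamma> (N - k) * st k) \<and>
    (\<forall>k\<in>{1..N}. Vt \<le> (\<Sum>j=1..<k. lt j) + \<gamma> (N - k + 1) * st k))"

end

theory Submission
  imports Defs
begin

text \<open>
  Take the optimal open-loop trajectory from \<open>x\<close>, with states \<open>x\<^sub>k\<close>, and record its stage costs, the
  values of \<open>W\<close> and \<open>\<sigma>\<close> along it, and the optimal cost \<open>V\<^sub>N x\<^sub>1\<close> at the successor state. Dynamic
  programming, controllability and detectability say that these numbers satisfy every constraint of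
  the linear program except the normalisation \<open>\<sigma>\<^sub>0 = 1\<close> (\<open>optimal_trajectory_lp_cone\<close>). All the
  other constraints are homogeneous, so they cut out a convex cone, and optimality of the program
  extends to the whole cone: the objective is at least \<open>\<epsilon>o * (\<alpha> - 1)\<close> times \<open>\<sigma> x\<close>
  (\<open>lp_objective_lower_bound_on_cone\<close>). Read for the trajectory, this is the key inequality
  \<open>V\<^sub>N x\<^sub>1 - V\<^sub>N x \<le> - l x (\<mu> x) - \<epsilon>o * (\<alpha> - 1) * \<sigma> x\<close> (\<open>mpc_value_decrease\<close>), and
  adding the detectability inequality gives the decrease of \<open>Y\<^sub>N\<close>.

  For the performance bound only \<open>\<alpha> > 0\<close> matters, since \<open>Y\<^sub>\<infinity>\<close> is nonnegative. Moreover \<open>\<alpha> \<le> 1\<close>,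
  because a point of the program that vanishes from step \<open>1\<close> on is feasible with objective \<open>0\<close>
  (\<open>lp_minimum_nonpos\<close>). Hence detectability may be multiplied by \<open>1 - \<alpha>\<close> and used to eliminate \<open>\<sigma>\<close>
  from the key inequality, which leaves
  \<open>\<alpha> * (l x (\<mu> x) + W x - W x\<^sub>1) \<le> Y\<^sub>N x - Y\<^sub>N x\<^sub>1\<close>. This telescopes along the closed loop,
  and \<open>Y\<^sub>N \<le> Y\<^sub>\<infinity>\<close> finishes the proof.
\<close>

section \<open>Dynamic programming\<close>

lemma traj_cong:
  assumes "\<And>i. i < j \<Longrightarrow> u i = v i"
  shows "traj f u x j = traj f v x j"
  using assms by (induction j) auto

lemma traj_add: "traj f u x (m + i) = traj f (\<lambda>i. u (m + i)) (traj f u x m) i"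
  by (induction i) auto

lemma cost_cong:
  assumes "\<And>i. i < k \<Longrightarrow> u i = v i"
  shows "cost f l k x u = cost f l k x v"
  unfolding cost_def
proof (rule sum.cong)
  fix j assume "j \<in> {..<k}"
  then show "l (traj f u x j) (u j) = l (traj f v x j) (v j)"
    using assms traj_cong[of j u v f x] by simp
qed simp

lemma cost_add:
  "cost f l (m + k) x u = cost f l m x u + cost f l k (traj f u x m) (\<lambda>i. u (m + i))"
  by (induction k) (simp_all add: cost_def traj_add add.assoc)

lemma cost_nonneg:
  assumes "\<And>x u. u \<in> U \<Longrightarrow> 0 \<le> l x u" and "\<And>i. i < k \<Longrightarrow> u i \<in> U"
  shows "0 \<le> cost f l k x u"
  unfolding cost_def using assms by (intro sum_nonneg) simp

lemma opt_cost_le_cost: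
  assumes l: "\<And>x u. u \<in> U \<Longrightarrow> 0 \<le> l x u" and u: "\<And>i. i < k \<Longrightarrow> u i \<in> U"
  shows "opt_cost f U l k x \<le> cost f l k x u"
proof -
  have "bdd_below (cost f l k x ` ({..<k} \<rightarrow>\<^sub>E U))"
    by (rule bdd_belowI2[where m = 0], rule cost_nonneg[OF l]) auto
  then have "opt_cost f U l k x \<le> cost f l k x (restrict u {..<k})"
    unfolding opt_cost_def by (rule cINF_lower) (use u in auto)
  also have "\<dots> = cost f l k x u"
    by (rule cost_cong) simp
  finally show ?thesis .
qed

lemma opt_cost_greatest:
  assumes "U \<noteq> {}" and "\<And>u. (\<And>i. i < k \<Longrightarrow> u i \<in> U) \<Longrightarrow> c \<le> cost f l k x u"
  shows "c \<le> opt_cost f U l k x"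
  unfolding opt_cost_def using assms by (intro cINF_greatest) (auto simp: PiE_eq_empty_iff)

text \<open>
  Any input over the first \<open>m\<close> steps can be continued by a near-optimal one from the state it reaches.
\<close>

lemma opt_cost_dynamic_programming:
  fixes f :: "real ^ 'n \<Rightarrow> real ^ 'm \<Rightarrow> real ^ 'n"
  assumes l: "\<And>x u. u \<in> U \<Longrightarrow> 0 \<le> l x u" and U: "U \<noteq> {}" and u: "\<And>i. i < m \<Longrightarrow> u i \<in> U"
  shows "opt_cost f U l (m + k) x \<le> cost f l m x u + opt_cost f U l k (traj f u x m)"
proof -
  have "opt_cost f U l (m + k) x - cost f l m x u \<le> opt_cost f U l k (traj f u x m)"
  proof (rule opt_cost_greatest[OF U])
    fix v :: "nat \<Rightarrow> real ^ 'm" assume v: "\<And>i. i < k \<Longrightarrow> v i \<in> U"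
    define w where "w i = (if i < m then u i else v (i - m))" for i
    have "opt_cost f U l (m + k) x \<le> cost f l (m + k) x w"
      by (rule opt_cost_le_cost[OF l]) (auto simp: w_def intro: u v)
    also have "\<dots> = cost f l m x w + cost f l k (traj f w x m) (\<lambda>i. w (m + i))"
      by (rule cost_add)
    also have "cost f l m x w = cost f l m x u"
      by (rule cost_cong) (simp add: w_def)
    also have "traj f w x m = traj f u x m"
      by (rule traj_cong) (simp add: w_def)
    also have "(\<lambda>i. w (m + i)) = v"
      by (simp add: w_def)
    finally show "opt_cost f U l (m + k) x - cost f l m x u \<le> cost f l k (traj f u x m) v"
      by simp
  qed
  then show ?thesis by simp
qed

lemma opt_cost_le_opt_cost_inf:
  fixes f :: "real ^ 'n \<Rightarrow> real ^ 'm \<Rightarrow> real ^ 'n"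
  assumes l: "\<And>x u. u \<in> U \<Longrightarrow> 0 \<le> l x u"
  shows "ereal (opt_cost f U l k x) \<le> opt_cost_inf f U l x"
  unfolding opt_cost_inf_def
proof (rule INF_greatest)
  fix u :: "nat \<Rightarrow> real ^ 'm" assume "u \<in> UNIV \<rightarrow> U"
  then have u: "u i \<in> U" for i by auto
  have "ereal (opt_cost f U l k x) \<le> ereal (cost f l k x u)"
    using opt_cost_le_cost[where U = U and l = l and k = k and u = u] l u by simp
  also have "\<dots> = (\<Sum>j<k. ereal (l (traj f u x j) (u j)))"
    by (simp add: cost_def)
  also have "\<dots> \<le> (\<Sum>j. ereal (l (traj f u x j) (u j)))"
    by (rule suminf_upper) (use l u in auto)
  finally show "ereal (opt_cost f U l k x) \<le> (\<Sum>j. ereal (l (traj f u x j) (u j)))" .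
qed

section \<open>The cone over the linear program\<close>

text \<open>
  The constraints of the linear program without the normalisation \<open>\<sigma>\<^sub>0 = 1\<close>. They are homogeneous,
  so trajectories can be inserted unscaled.
\<close>

definition lp_cone :: "nat \<Rightarrow> (nat \<Rightarrow> real) \<Rightarrow> real \<Rightarrow> real \<Rightarrow> real \<Rightarrow> lp_point \<Rightarrow> bool"
  where "lp_cone N \<gamma> \<epsilon>o \<gamma>lo \<gamma>hi = (\<lambda>(lt, Wt, st, Vt).
    (\<forall>k<N. 0 \<le> lt k) \<and>
    (\<forall>k\<le>N. 0 \<le> st k \<and> 0 \<le> Wt k) \<and>
    (\<forall>k\<le>N. \<gamma>lo * st k \<le> Wt k \<and> Wt k \<le> \<gamma>hi * st k) \<and>
    (\<forall>k<N. Wt (k + 1) - Wt k \<le> - \<epsilon>o * st k + lt k) \<and>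
    (\<forall>k<N. (\<Sum>j=k..<N. lt j) \<le> \<gamma> (N - k) * st k) \<and>
    (\<forall>k\<in>{1..N}. Vt \<le> (\<Sum>j=1..<k. lt j) + \<gamma> (N - k + 1) * st k))"

lemma lp_feasible_iff_lp_cone:
  "lp_feasible N \<gamma> \<epsilon>o \<gamma>lo \<gamma>hi (lt, Wt, st, Vt) \<longleftrightarrow>
     st 0 = 1 \<and> lp_cone N \<gamma> \<epsilon>o \<gamma>lo \<gamma>hi (lt, Wt, st, Vt)"
  by (simp add: lp_feasible_def lp_cone_def)

lemma lp_cone_add:
  assumes "lp_cone N \<gamma> \<epsilon>o \<gamma>lo \<gamma>hi (lt, Wt, st, Vt)"
    and "lp_cone N \<gamma> \<epsilon>o \<gamma>lo \<gamma>hi (lt', Wt', st', Vt')"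
  shows "lp_cone N \<gamma> \<epsilon>o \<gamma>lo \<gamma>hi
           (\<lambda>k. lt k + lt' k, \<lambda>k. Wt k + Wt' k, \<lambda>k. st k + st' k, Vt + Vt')"
  using assms unfolding lp_cone_def by (fastforce simp: sum.distrib algebra_simps)

lemma lp_cone_scale:
  assumes "lp_cone N \<gamma> \<epsilon>o \<gamma>lo \<gamma>hi (lt, Wt, st, Vt)" and "0 \<le> c"
  shows "lp_cone N \<gamma> \<epsilon>o \<gamma>lo \<gamma>hi (\<lambda>k. c * lt k, \<lambda>k. c * Wt k, \<lambda>k. c * st k, c * Vt)"
proof -
  have scale: "c * a \<le> c * b" if "a \<le> b" for a b :: real
    using that assms(2) by (rule mult_left_mono)
  show ?thesis
    unfolding lp_cone_def prod.case
  proof (intro conjI allI impI ballI)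
    fix k assume k: "k < N"
    show "0 \<le> c * lt k"
      using assms k by (simp add: lp_cone_def)
    show "c * Wt (k + 1) - c * Wt k \<le> - \<epsilon>o * (c * st k) + c * lt k"
      using scale[of "Wt (k + 1) - Wt k" "- \<epsilon>o * st k + lt k"] assms k
      by (simp add: lp_cone_def algebra_simps)
    show "(\<Sum>j=k..<N. c * lt j) \<le> \<gamma> (N - k) * (c * st k)"
      using scale[of "\<Sum>j=k..<N. lt j" "\<gamma> (N - k) * st k"] assms k
      by (simp add: lp_cone_def sum_distrib_left mult.left_commute)
  next
    fix k assume k: "k \<le> N"
    show "0 \<le> c * st k" "0 \<le> c * Wt k"
      using assms k by (simp_all add: lp_cone_def)
    show "\<gamma>lo * (c * st k) \<le> c * Wt k" "c * Wt k \<le> \<gamma>hi * (c * st k)"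
      using scale[of "\<gamma>lo * st k" "Wt k"] scale[of "Wt k" "\<gamma>hi * st k"] assms k
      by (simp_all add: lp_cone_def mult.left_commute)
  next
    fix k assume k: "k \<in> {1..N}"
    show "c * Vt \<le> (\<Sum>j=1..<k. c * lt j) + \<gamma> (N - k + 1) * (c * st k)"
      using scale[of Vt "(\<Sum>j=1..<k. lt j) + \<gamma> (N - k + 1) * st k"] assms k
      by (simp add: lp_cone_def distrib_left sum_distrib_left mult.left_commute)
  qed
qed

text \<open>
  Adding a minimizer \<open>p\<close> to a point \<open>q\<close> of the cone with \<open>\<sigma>\<^sub>0 = s\<close> and dividing by \<open>1 + s\<close> gives a
  feasible point, whose objective is at least that of \<open>p\<close>. Dividing \<open>q\<close> by \<open>s\<close> instead would fail
  for \<open>s = 0\<close>; here \<open>q\<close> is then a recession direction, and the existence of a minimum is what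
  forces its objective to be nonnegative.
\<close>

lemma lp_objective_lower_bound_on_cone:
  assumes p: "is_arg_min (lp_objective N) (lp_feasible N \<gamma> \<epsilon>o \<gamma>lo \<gamma>hi) p"
    and q: "lp_cone N \<gamma> \<epsilon>o \<gamma>lo \<gamma>hi (lt, Wt, st, Vt)"
  shows "lp_objective N p * st 0 \<le> lp_objective N (lt, Wt, st, Vt)"
proof -
  obtain lp Wp sp Vp where p_eq: "p = (lp, Wp, sp, Vp)" by (cases p)
  have feas: "sp 0 = 1" "lp_cone N \<gamma> \<epsilon>o \<gamma>lo \<gamma>hi (lp, Wp, sp, Vp)"
    using p unfolding is_arg_min_def p_eq lp_feasible_iff_lp_cone by auto
  have s: "0 \<le> st 0" using q by (simp add: lp_cone_def)
  define c where "c = 1 / (1 + st 0)"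
  have c: "0 < c" "c * (1 + st 0) = 1" using s by (simp_all add: c_def)
  define r :: lp_point where
    "r = (\<lambda>k. c * (lp k + lt k), \<lambda>k. c * (Wp k + Wt k), \<lambda>k. c * (sp k + st k), c * (Vp + Vt))"
  have "lp_feasible N \<gamma> \<epsilon>o \<gamma>lo \<gamma>hi r"
    unfolding r_def lp_feasible_iff_lp_cone
    using lp_cone_scale[OF lp_cone_add[OF feas(2) q], of c] c feas(1) by simp
  then have "lp_objective N p \<le> lp_objective N r"
    using p by (simp add: is_arg_min_linorder del: split_paired_All)
  also have "\<dots> = c * (lp_objective N p + lp_objective N (lt, Wt, st, Vt))"
    by (simp add: r_def p_eq lp_objective_def algebra_simps sum.distrib sum_distrib_left)
  finally have "(1 + st 0) * lp_objective N p
      \<le> (c * (1 + st 0)) * (lp_objective N p + lp_objective N (lt, Wt, st, Vt))"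
    using mult_left_mono[of "lp_objective N p" _ "1 + st 0"] s by (simp add: mult_ac)
  then show ?thesis unfolding c(2) by (simp add: algebra_simps)
qed

text \<open>
  Keep the first stage cost and storage value of any feasible point and let everything vanish from
  step \<open>1\<close> on: the constraints survive, and the objective becomes \<open>0\<close>.
\<close>

lemma lp_minimum_nonpos:
  assumes p: "is_arg_min (lp_objective N) (lp_feasible N \<gamma> \<epsilon>o \<gamma>lo \<gamma>hi) p" and N: "1 \<le> N"
  shows "lp_objective N p \<le> 0"
proof -
  obtain lp Wp sp Vp where p_eq: "p = (lp, Wp, sp, Vp)" by (cases p)
  have feas: "sp 0 = 1" "lp_cone N \<gamma> \<epsilon>o \<gamma>lo \<gamma>hi (lp, Wp, sp, Vp)"
    using p unfolding is_arg_min_def p_eq lp_feasible_iff_lp_cone by auto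
  define r :: lp_point where
    "r = (\<lambda>k. if k = 0 then lp 0 else 0, \<lambda>k. if k = 0 then Wp 0 else 0,
          \<lambda>k. if k = 0 then 1 else 0, 0)"
  have l0: "0 \<le> lp 0" and W1: "0 \<le> Wp 1"
    and det: "Wp 1 - Wp 0 \<le> - \<epsilon>o + lp 0"
    and ctr: "(\<Sum>j=0..<N. lp j) \<le> \<gamma> N"
    using feas N by (auto simp: lp_cone_def dest: spec[of _ 0])
  have "lp 0 \<le> (\<Sum>j=0..<N. lp j)"
    using feas(2) N by (intro member_le_sum) (auto simp: lp_cone_def)
  with ctr have l0_le: "lp 0 \<le> \<gamma> N" by simp
  have tail: "(\<Sum>j=k..<N. if j = 0 then lp 0 else 0) = (if k = 0 then lp 0 else 0)" for k
    using N by (simp add: sum.delta)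
  have "lp_feasible N \<gamma> \<epsilon>o \<gamma>lo \<gamma>hi r"
    using feas l0 W1 det l0_le unfolding r_def lp_feasible_def lp_cone_def
    by (auto simp: tail)
  then have "lp_objective N p \<le> lp_objective N r"
    using p by (simp add: is_arg_min_linorder del: split_paired_All)
  also have "lp_objective N r = 0"
    by (simp add: r_def lp_objective_def)
  finally show ?thesis .
qed

section \<open>Optimal trajectories and the closed loop\<close>

text \<open>
  The two families of cost constraints are dynamic programming at intermediate states: a tail of an
  optimal trajectory costs at most the optimal cost from its initial state, and the successor state
  can follow the trajectory up to step \<open>k\<close> and behave optimally afterwards.
\<close>

lemma optimal_trajectory_lp_cone:
  fixes f :: "real ^ 'n \<Rightarrow> real ^ 'm \<Rightarrow> real ^ 'n"
  assumes l: "\<And>x u. u \<in> U \<Longrightarrow> 0 \<le> l x u"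
    and N: "1 \<le> N"
    and u: "\<And>i. i < N \<Longrightarrow> u i \<in> U"
    and opt: "cost f l N x u \<le> opt_cost f U l N x"
    and \<sigma>: "\<And>x. 0 \<le> \<sigma> x"
    and ctr: "\<And>x k. 1 \<le> k \<Longrightarrow> opt_cost f U l k x \<le> \<gamma> k * \<sigma> x"
    and W: "\<And>x. 0 \<le> W x"
    and W_bounds: "\<And>x. \<gamma>lo * \<sigma> x \<le> W x \<and> W x \<le> \<gamma>hi * \<sigma> x"
    and det: "\<And>x u. u \<in> U \<Longrightarrow> W (f x u) - W x \<le> - \<epsilon>o * \<sigma> x + l x u"
  shows "lp_cone N \<gamma> \<epsilon>o \<gamma>lo \<gamma>hi
    (\<lambda>k. l (traj f u x k) (u k), \<lambda>k. W (traj f u x k), \<lambda>k. \<sigma> (traj f u x k),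
     opt_cost f U l N (f x (u 0)))"
  unfolding lp_cone_def prod.case
proof (intro conjI allI impI ballI)
  have U: "U \<noteq> {}" using u[of 0] N by auto
  fix k assume k: "k < N"
  show "0 \<le> l (traj f u x k) (u k)" using l u k by simp
  show "W (traj f u x (k + 1)) - W (traj f u x k) \<le> - \<epsilon>o * \<sigma> (traj f u x k) + l (traj f u x k) (u k)"
    using det[OF u[OF k]] by simp
  have "cost f l N x u = cost f l k x u + (\<Sum>j=k..<N. l (traj f u x j) (u j))"
    unfolding cost_def using k sum.atLeastLessThan_concat[of 0 k N "\<lambda>j. l (traj f u x j) (u j)"]
    by (simp add: atLeast0LessThan)
  moreover have "opt_cost f U l N x \<le> cost f l k x u + opt_cost f U l (N - k) (traj f u x k)"
    using opt_cost_dynamic_programming[where l = l and m = k and k = "N - k", OF l U] u k by simp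
  moreover have "opt_cost f U l (N - k) (traj f u x k) \<le> \<gamma> (N - k) * \<sigma> (traj f u x k)"
    using ctr k by simp
  ultimately show "(\<Sum>j=k..<N. l (traj f u x j) (u j)) \<le> \<gamma> (N - k) * \<sigma> (traj f u x k)"
    using opt by linarith
next
  have U: "U \<noteq> {}" using u[of 0] N by auto
  fix k assume k: "k \<in> {1..N}"
  then obtain m where m: "k = Suc m" "m < N" by (cases k) auto
  define v where "v i = u (Suc i)" for i
  have v: "v i \<in> U" if "i < m" for i using that u m by (simp add: v_def)
  have shift: "traj f v (f x (u 0)) i = traj f u x (Suc i)" for i
    using traj_add[of f u x 1 i] by (simp add: v_def[abs_def])
  have "opt_cost f U l N (f x (u 0))
      \<le> cost f l m (f x (u 0)) v + opt_cost f U l (N - m) (traj f v (f x (u 0)) m)"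
    using opt_cost_dynamic_programming[where l = l and m = m and k = "N - m", OF l U v] m by simp
  also have "cost f l m (f x (u 0)) v = (\<Sum>j=1..<k. l (traj f u x j) (u j))"
    unfolding cost_def shift v_def m(1)
    by (simp only: One_nat_def sum.shift_bounds_Suc_ivl atLeast0LessThan)
  also have "opt_cost f U l (N - m) (traj f v (f x (u 0)) m) \<le> \<gamma> (N - k + 1) * \<sigma> (traj f u x k)"
    using ctr[of "N - m" "traj f u x k"] m unfolding shift by (simp add: Suc_diff_Suc)
  finally show "opt_cost f U l N (f x (u 0))
      \<le> (\<Sum>j=1..<k. l (traj f u x j) (u j)) + \<gamma> (N - k + 1) * \<sigma> (traj f u x k)"
    by simp
qed (use \<sigma> W W_bounds in auto)

text \<open>
  The objective of the trajectory is \<open>V\<^sub>N x - l x (u 0) - V\<^sub>N x\<^sub>1\<close>, because its stage costs from step \<open>1\<close> on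
  are what remains of the optimal cost.
\<close>

lemma mpc_value_decrease:
  fixes f :: "real ^ 'n \<Rightarrow> real ^ 'm \<Rightarrow> real ^ 'n"
  assumes cone: "lp_cone N \<gamma> \<epsilon>o \<gamma>lo \<gamma>hi
      (\<lambda>k. l (traj f u x k) (u k), \<lambda>k. W (traj f u x k), \<lambda>k. \<sigma> (traj f u x k),
       opt_cost f U l N (f x (u 0)))"
    and N: "1 \<le> N"
    and opt: "cost f l N x u \<le> opt_cost f U l N x"
    and p: "is_arg_min (lp_objective N) (lp_feasible N \<gamma> \<epsilon>o \<gamma>lo \<gamma>hi) p"
    and \<alpha>: "\<epsilon>o * (\<alpha> - 1) = lp_objective N p"
  shows "opt_cost f U l N (f x (u 0)) + l x (u 0) + \<epsilon>o * (\<alpha> - 1) * \<sigma> x \<le> opt_cost f U l N x"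
proof -
  have "cost f l N x u = l x (u 0) + (\<Sum>k=1..<N. l (traj f u x k) (u k))"
    unfolding cost_def using N by (simp add: atLeast0LessThan[symmetric] sum.atLeast_Suc_lessThan)
  moreover have "lp_objective N p * \<sigma> x
      \<le> (\<Sum>k=1..<N. l (traj f u x k) (u k)) - opt_cost f U l N (f x (u 0))"
    using lp_objective_lower_bound_on_cone[OF p cone] by (simp add: lp_objective_def)
  ultimately show ?thesis using opt by (simp add: \<alpha>)
qed

theorem theorem2:
  fixes f :: "real ^ 'n \<Rightarrow> real ^ 'm \<Rightarrow> real ^ 'n"
    and U :: "(real ^ 'm) set"
    and l :: "real ^ 'n \<Rightarrow> real ^ 'm \<Rightarrow> real"
    and N :: nat
    and ustar :: "real ^ 'n \<Rightarrow> nat \<Rightarrow> real ^ 'm"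
    and \<mu> :: "real ^ 'n \<Rightarrow> real ^ 'm"
    and \<sigma> W :: "real ^ 'n \<Rightarrow> real"
    and \<gamma> :: "nat \<Rightarrow> real"
    and \<gamma>bar \<epsilon>o \<gamma>lo \<gamma>hi \<alpha> :: real
  assumes stage_cost_nonneg: "\<And>x u. u \<in> U \<Longrightarrow> 0 \<le> l x u"
    and horizon: "1 \<le> N"
    and minimizer: "\<And>x. is_arg_min (cost f l N x) (\<lambda>u. u \<in> {..<N} \<rightarrow>\<^sub>E U) (ustar x)"
    and feedback: "\<And>x. \<mu> x = ustar x 0"
    and sigma_nonneg: "\<And>x. 0 \<le> \<sigma> x"
    and gamma_bar: "0 \<le> \<gamma>bar"
    and gamma_bounds: "\<And>k. 1 \<le> k \<Longrightarrow> \<gamma> k \<in> {0..\<gamma>bar}"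
    and cost_controllability: "\<And>x k. 1 \<le> k \<Longrightarrow> opt_cost f U l k x \<le> \<gamma> k * \<sigma> x"
    and W_nonneg: "\<And>x. 0 \<le> W x"
    and eps_pos: "0 < \<epsilon>o"
    and gamma_lo: "0 \<le> \<gamma>lo"
    and gamma_hi: "0 \<le> \<gamma>hi"
    and W_bounds: "\<And>x. \<gamma>lo * \<sigma> x \<le> W x \<and> W x \<le> \<gamma>hi * \<sigma> x"
    and cost_detectability: "\<And>x u. u \<in> U \<Longrightarrow> W (f x u) - W x \<le> - \<epsilon>o * \<sigma> x + l x u"
    and alpha: "\<exists>p. is_arg_min (lp_objective N) (lp_feasible N \<gamma> \<epsilon>o \<gamma>lo \<gamma>hi) p \<and>
                    \<epsilon>o * (\<alpha> - 1) = lp_objective N p"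
  shows "(\<forall>x. \<epsilon>o * \<sigma> x \<le> opt_cost f U l N x + W x \<and>
              opt_cost f U l N x + W x \<le> (\<gamma> N + \<gamma>hi) * \<sigma> x \<and>
              (opt_cost f U l N (f x (\<mu> x)) + W (f x (\<mu> x))) - (opt_cost f U l N x + W x)
                \<le> - \<epsilon>o * \<alpha> * \<sigma> x) \<and>
         (\<forall>x0. ereal \<alpha> * (closed_loop_cost f l \<mu> x0 + ereal (W x0))
                \<le> opt_cost_inf f U l x0 + ereal (W x0))"
proof -
  obtain p where p: "is_arg_min (lp_objective N) (lp_feasible N \<gamma> \<epsilon>o \<gamma>lo \<gamma>hi) p"
    and p_eq: "\<epsilon>o * (\<alpha> - 1) = lp_objective N p"
    using alpha by blast
  let ?V = "opt_cost f U l N"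
  have ustar: "ustar x i \<in> U" if "i < N" for x i
    using minimizer[of x] that unfolding is_arg_min_def by (auto simp: PiE_iff)
  have U: "U \<noteq> {}" using ustar[of 0] horizon by auto
  have \<mu>_in: "\<mu> x \<in> U" for x using ustar[of 0 x] horizon by (simp add: feedback)
  have opt: "cost f l N x (ustar x) \<le> ?V x" for x
    unfolding opt_cost_def
  proof (rule cINF_greatest)
    show "{..<N} \<rightarrow>\<^sub>E U \<noteq> {}" using U by (simp add: PiE_eq_empty_iff)
  qed (use minimizer[of x] in \<open>auto simp: is_arg_min_linorder\<close>)
  have V_nonneg: "0 \<le> ?V x" for x
    by (rule opt_cost_greatest[OF U], rule cost_nonneg[OF stage_cost_nonneg])
  have first_stage: "l x (\<mu> x) \<le> ?V x" for x
  proof -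
    have "l (traj f (ustar x) x 0) (ustar x 0) \<le> cost f l N x (ustar x)"
      unfolding cost_def using horizon
      by (intro member_le_sum) (auto intro: stage_cost_nonneg ustar)
    with opt[of x] show ?thesis by (simp add: feedback)
  qed
  have V_decrease: "?V (f x (\<mu> x)) + l x (\<mu> x) + \<epsilon>o * (\<alpha> - 1) * \<sigma> x \<le> ?V x" for x
    unfolding feedback
    by (rule mpc_value_decrease[OF optimal_trajectory_lp_cone[where W = W and \<sigma> = \<sigma>]
          horizon opt p p_eq])
      (use stage_cost_nonneg horizon ustar opt sigma_nonneg cost_controllability W_nonneg
        W_bounds cost_detectability in auto)
  have detect: "W (f x (\<mu> x)) - W x \<le> - \<epsilon>o * \<sigma> x + l x (\<mu> x)" for x
    by (rule cost_detectability[OF \<mu>_in])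

  have lower: "\<epsilon>o * \<sigma> x \<le> ?V x + W x" for x
    using detect[of x] first_stage[of x] W_nonneg[of "f x (\<mu> x)"] by simp
  have upper: "?V x + W x \<le> (\<gamma> N + \<gamma>hi) * \<sigma> x" for x
    using cost_controllability[OF horizon, of x] W_bounds[of x] by (simp add: distrib_right)
  have decrease: "(?V (f x (\<mu> x)) + W (f x (\<mu> x))) - (?V x + W x) \<le> - \<epsilon>o * \<alpha> * \<sigma> x" for x
    using V_decrease[of x] detect[of x] by (simp add: algebra_simps)

  have "ereal \<alpha> * (closed_loop_cost f l \<mu> x0 + ereal (W x0))
      \<le> opt_cost_inf f U l x0 + ereal (W x0)" for x0
  proof -
    define xc where "xc = closed_loop f \<mu> x0"
    define lc where "lc k = l (xc k) (\<mu> (xc k))" for k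
    have lc_nonneg: "0 \<le> lc k" for k
      unfolding lc_def by (rule stage_cost_nonneg[OF \<mu>_in])
    have J: "closed_loop_cost f l \<mu> x0 = (\<Sum>k. ereal (lc k))"
      by (simp add: closed_loop_cost_def lc_def xc_def)
    have J_nonneg: "0 \<le> closed_loop_cost f l \<mu> x0"
      unfolding J using lc_nonneg by (intro suminf_0_le summable_ereal_pos) simp_all
    have Y: "ereal (?V x0 + W x0) \<le> opt_cost_inf f U l x0 + ereal (W x0)"
      using add_right_mono[OF opt_cost_le_opt_cost_inf[OF stage_cost_nonneg], where c = "ereal (W x0)"]
      by simp
    have Y_nonneg: "0 \<le> opt_cost_inf f U l x0 + ereal (W x0)"
      using V_nonneg[of x0] W_nonneg[of x0] by (intro order_trans[OF _ Y]) simp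
    show ?thesis
    proof (cases "\<alpha> \<le> 0")
      case True
      have "0 \<le> closed_loop_cost f l \<mu> x0 + ereal (W x0)"
        using J_nonneg W_nonneg[of x0] by simp
      then have "ereal \<alpha> * (closed_loop_cost f l \<mu> x0 + ereal (W x0)) \<le> 0"
        using True by (simp add: ereal_mult_le_0_iff)
      then show ?thesis using Y_nonneg by (rule order_trans)
    next
      case False
      have \<alpha>_le: "\<alpha> \<le> 1"
        using lp_minimum_nonpos[OF p horizon] eps_pos
        unfolding p_eq[symmetric] by (simp add: mult_le_0_iff)
      have step: "\<alpha> * (l x (\<mu> x) + W x - W (f x (\<mu> x)))
          \<le> (?V x + W x) - (?V (f x (\<mu> x)) + W (f x (\<mu> x)))" for x
        using V_decrease[of x] mult_left_mono[OF detect[of x], of "1 - \<alpha>"] \<alpha>_le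
        by (simp add: algebra_simps)
      have telescope: "\<alpha> * ((\<Sum>k<K. lc k) + W x0 - W (xc K))
          \<le> (?V x0 + W x0) - (?V (xc K) + W (xc K))" for K
      proof (induction K)
        case 0
        show ?case by (simp add: xc_def)
      next
        case (Suc K)
        have "xc (Suc K) = f (xc K) (\<mu> (xc K))" by (simp add: xc_def)
        then show ?case using Suc step[of "xc K"] by (simp add: lc_def algebra_simps)
      qed
      have partial: "\<alpha> * ((\<Sum>k<K. lc k) + W x0) \<le> ?V x0 + W x0" for K
      proof -
        \<comment> \<open>the terminal terms leave \<open>V\<^sub>N + (1 - \<alpha>) * W\<close> at \<open>xc K\<close>, which may be dropped\<close>
        have "\<alpha> * W (xc K) \<le> W (xc K)"
          using mult_right_mono[OF \<alpha>_le W_nonneg[of "xc K"]] by simp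
        then show ?thesis
          using telescope[of K] V_nonneg[of "xc K"] by (simp add: algebra_simps)
      qed
      have "closed_loop_cost f l \<mu> x0 \<le> ereal ((?V x0 + W x0) / \<alpha> - W x0)"
        unfolding J
      proof (rule suminf_bound, rule allI)
        fix K
        have "(\<Sum>k<K. lc k) \<le> (?V x0 + W x0) / \<alpha> - W x0"
          using partial[of K] False by (simp add: field_simps)
        then show "(\<Sum>k<K. ereal (lc k)) \<le> ereal ((?V x0 + W x0) / \<alpha> - W x0)" by simp
      qed (use lc_nonneg in auto)
      then have "closed_loop_cost f l \<mu> x0 + ereal (W x0) \<le> ereal ((?V x0 + W x0) / \<alpha>)"
        using add_right_mono[of "closed_loop_cost f l \<mu> x0" "ereal ((?V x0 + W x0) / \<alpha> - W x0)"
            "ereal (W x0)"] by simp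
      then have "ereal \<alpha> * (closed_loop_cost f l \<mu> x0 + ereal (W x0))
          \<le> ereal \<alpha> * ereal ((?V x0 + W x0) / \<alpha>)"
        using False by (intro ereal_mult_left_mono) auto
      also have "\<dots> = ereal (?V x0 + W x0)" using False by simp
      finally show ?thesis using Y by (rule order_trans)
    qed
  qed
  with lower upper decrease show ?thesis by blast
qed

end
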